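(* Let $V$ be a purely affective interaction among individuals $1,\dots,n$ with action sets $X_1,\dots,X_n$ and utility functions $V_i(x_i,u_{-i})$. Assume that each $X_i$ is an open subset of a Euclidean space, that each $V_i$ is twice continuously differentiable, and that for every $x\in X=\prod_{i=1}^n X_i$ and every $u\in\mathbb{R}^n$ the matrix $I-J_x(u)$ is a P-matrix. If $(x^*,u^* )\in X\times\mathbb{R}^n$ is a parametric equilibrium, then $(x^*,u^* )$ is Pareto optimal; that is, there is no consistent profile $(\tilde x,\tilde u)\in X\times\mathbb{R}^n$ with $\tilde u>u^*$.
   Context: Purely affective interaction: individuals $i\in\{1,\dots,n\}$ have action sets $X_i$, with $X=\prod_{i=1}^n X_i$. Each individual has a utility function $V_i(x_i,u_{-i})\in\mathbb{R}$ depending only on her own action $x_i\in X_i$ and on the utility levels $u_{-i}=(u_j)_{j\ne i}\in\mathbb{R}^{n-1}$ of the others. For $x\in X$, $u\in\mathbb{R}^n$ write $V_x(u)=(V_i(x_i,u_{-i}))_{i=1}^n\in\mathbb{R}^n$. $J_x(u)$ denotes the $n\times n$ Jacobian matrix of the map $V_x:\mathbb{R}^n\to\mathbb{R}^n$ at $u$ (so its diagonal is zero). $I$ is the identity matrix. Order on $\mathbb{R}^n$: $u\le \bar u$ means $u_i\le\bar u_i$ for all $i$; $u<\bar u$ means $u_i\le\bar u_i$ for all $i$ with at least one strict inequality. P-matrix: a square real matrix all of whose principal minors are positive. Consistent: a profile $(x,u)\in X\times\mathbb{R}^n$ is consistent if $V_x(u)=u$. Parametric equilibrium: a consistent profile $(x^*,u^*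 )$ such that $V_x(u^* )\le V_{x^*}(u^* )$ for every $x\in X$. Pareto optimal: a consistent profile $(x,u)$ is Pareto optimal if there is no consistent profile $(\tilde x,\tilde u)$ with $\tilde u>u$. *)

theory Defs
  imports "HOL-Analysis.Analysis"
begin

text \<open>
  The individuals are the elements of a finite type \<open>'n\<close>. The action sets may lie in Euclidean spaces
  of different dimensions: individual \<open>i\<close> has her own Euclidean space \<open>E i\<close>, a linear subspace of a
  common (arbitrary) \<open>'a::euclidean_space\<close>, and \<open>X i\<close> is open relative to \<open>E i\<close>.
  A utility function takes the whole utility vector; that it is really a function of
  \<open>u\<^sub>-\<^sub>i\<close> is the predicate \<open>purely_affective\<close>.
\<close>

definition purely_affective ::
    "('n::finite \<Rightarrow> 'a set) \<Rightarrow> ('n \<Rightarrow> 'a \<Rightarrow> real^'n \<Rightarrow> real) \<Rightarrow> bool" where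
  "purely_affective X V \<longleftrightarrow>
     (\<forall>i. \<forall>y\<in>X i. \<forall>u u'. (\<forall>j. j \<noteq> i \<longrightarrow> u $ j = u' $ j) \<longrightarrow> V i y u = V i y u')"

definition utility_map ::
    "('n::finite \<Rightarrow> 'a \<Rightarrow> real^'n \<Rightarrow> real) \<Rightarrow> ('n \<Rightarrow> 'a) \<Rightarrow> real^'n \<Rightarrow> real^'n" where
  "utility_map V x u = (\<chi> i. V i (x i) u)"

text \<open>
  Twice continuously differentiable on \<open>U\<close>, where \<open>U\<close> is open in a linear subspace \<open>W\<close>. The derivatives
  are taken within \<open>U\<close>, so only their action on \<open>W\<close> is determined by \<open>f\<close>; their values off \<open>W\<close> put no
  constraint on \<open>f\<close>, since a derivative on \<open>W\<close> extends by composition with the orthogonal projection.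
\<close>

definition C2_on :: "'e::euclidean_space set \<Rightarrow> ('e \<Rightarrow> real) \<Rightarrow> bool" where
  "C2_on U f \<longleftrightarrow>
     (\<exists>(f' :: 'e \<Rightarrow> 'e \<Rightarrow>\<^sub>L real) (f'' :: 'e \<Rightarrow> 'e \<Rightarrow>\<^sub>L ('e \<Rightarrow>\<^sub>L real)).
        (\<forall>z\<in>U. (f has_derivative blinfun_apply (f' z)) (at z within U)) \<and>
        (\<forall>z\<in>U. (f' has_derivative blinfun_apply (f'' z)) (at z within U)) \<and>
        continuous_on U f'')"

text \<open>
  The determinant of the submatrix with rows and columns in \<open>S\<close>: the library's formula for \<open>det\<close>,
  with \<open>S\<close> in place of the full index type (see \<open>det_submatrix\<close>).
\<close>

definition principal_minor :: "real^'n^'n \<Rightarrow> 'n::finite set \<Rightarrow> real" where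
  "principal_minor A S = (\<Sum>p | p permutes S. of_int (sign p) * (\<Prod>i\<in>S. A $ i $ p i))"

definition P_matrix :: "real^'n^'n::finite \<Rightarrow> bool" where
  "P_matrix A \<longleftrightarrow> (\<forall>S. S \<noteq> {} \<longrightarrow> principal_minor A S > 0)"

lemma principal_minor_UNIV: "principal_minor A UNIV = det A"
  by (simp add: principal_minor_def det_def)

lemma det_submatrix:
  fixes A :: "real^'n^'n" and f :: "'m::finite \<Rightarrow> 'n::finite"
  assumes "inj f"
  shows "det (\<chi> i j. A $ f i $ f j) = principal_minor A (range f)"
proof -
  have bij: "bij_betw f UNIV (range f)"
    using assms by (simp add: bij_betw_def)
  have inv: "inv_into UNIV f ` range f = UNIV" "inj_on (inv_into UNIV f) (range f)"
    using assms by (auto simp: inj_on_inv_into)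
  show ?thesis
    unfolding principal_minor_def det_def
  proof (rule sum.reindex_bij_witness[where j = "map_permutation UNIV f"
        and i = "map_permutation (range f) (inv_into UNIV f)"])
    fix p :: "'m \<Rightarrow> 'm"
    assume p: "p \<in> {p. p permutes UNIV}"
    show "map_permutation (range f) (inv_into UNIV f) (map_permutation UNIV f p) = p"
      by (rule map_permutation_compose_inv[OF bij]) (use p assms in auto)
    show "map_permutation UNIV f p \<in> {p. p permutes range f}"
      using map_permutation_permutes[OF bij] p by auto
    have "(\<Prod>i\<in>range f. A $ i $ map_permutation UNIV f p i) = (\<Prod>i\<in>UNIV. A $ f i $ f (p i))"
      using assms by (simp add: prod.reindex map_permutation_apply)
    thus "of_int (sign (map_permutation UNIV f p)) *
        (\<Prod>i\<in>range f. A $ i $ map_permutation UNIV f p i) =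
        of_int (sign p) * (\<Prod>i\<in>UNIV. (\<chi> i j. A $ f i $ f j) $ i $ p i)"
      using p assms by (simp add: sign_map_permutation)
  next
    fix q :: "'n \<Rightarrow> 'n"
    assume q: "q \<in> {q. q permutes range f}"
    have bij': "bij_betw (inv_into UNIV f) (range f) UNIV"
      using bij by (rule bij_betw_inv_into)
    show "map_permutation UNIV f (map_permutation (range f) (inv_into UNIV f) q) = q"
      by (rule map_permutation_compose_inv[OF bij']) (use q in \<open>auto simp: f_inv_into_f\<close>)
    show "map_permutation (range f) (inv_into UNIV f) q \<in> {p. p permutes UNIV}"
      using map_permutation_permutes[OF bij'] q by auto
  qed
qed

definition consistent ::
    "('n::finite \<Rightarrow> 'a set) \<Rightarrow> ('n \<Rightarrow> 'a \<Rightarrow> real^'n \<Rightarrow> real) \<Rightarrow> ('n \<Rightarrow> 'a) \<Rightarrow> real^'n \<Rightarrow> bool" where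
  "consistent X V x u \<longleftrightarrow> x \<in> Pi UNIV X \<and> utility_map V x u = u"

text \<open>
  On \<^typ>\<open>real^'n\<close>, \<open>u \<le> v\<close> is the componentwise order and \<open>u < v\<close> means \<open>u \<le> v \<and> \<not> v \<le> u\<close>, that is,
  \<open>\<le>\<close> in all components and strict in at least one.
\<close>

definition parametric_equilibrium ::
    "('n::finite \<Rightarrow> 'a set) \<Rightarrow> ('n \<Rightarrow> 'a \<Rightarrow> real^'n \<Rightarrow> real) \<Rightarrow> ('n \<Rightarrow> 'a) \<Rightarrow> real^'n \<Rightarrow> bool" where
  "parametric_equilibrium X V xs us \<longleftrightarrow>
     consistent X V xs us \<and> (\<forall>x \<in> Pi UNIV X. utility_map V x us \<le> utility_map V xs us)"

definition pareto_optimal ::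
    "('n::finite \<Rightarrow> 'a set) \<Rightarrow> ('n \<Rightarrow> 'a \<Rightarrow> real^'n \<Rightarrow> real) \<Rightarrow> ('n \<Rightarrow> 'a) \<Rightarrow> real^'n \<Rightarrow> bool" where
  "pareto_optimal X V x u \<longleftrightarrow>
     consistent X V x u \<and> \<not> (\<exists>x' u'. consistent X V x' u' \<and> u < u')"

end

theory Submission
  imports Defs
begin

text \<open>
  Put \<open>F u = u - V\<^sub>x u\<close> for the action profile \<open>x\<close> of a hypothetical Pareto improvement \<open>u'\<close> of \<open>us\<close>.
  Consistency gives \<open>F u' = 0\<close> and the equilibrium property gives \<open>0 \<le> F us\<close>, so \<open>us \<le> u'\<close> and
  \<open>F u' \<le> F us\<close>. By the theorem of Gale and Nikaido on maps whose Jacobians are P-matrices this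
  forces \<open>u' = us\<close>. Their argument: \<open>us\<close> is an isolated point of
  \<open>{u. us \<le> u \<le> u' \<and> F u \<le> F us}\<close>; a minimal other point of this set either shares a coordinate with
  \<open>us\<close>, which lowers the dimension, or can be decreased further, because a P-matrix maps some
  positive vector to a positive vector.
\<close>

section \<open>P-matrices\<close>

text \<open>The entry at \<open>(k, k)\<close> enters only the terms of permutations fixing
  \<open>k\<close>, and these are the permutations of \<open>S - {k}\<close>.\<close>

lemma principal_minor_add_diagonal_entry:
  fixes A :: "real^'n^'n::finite"
  assumes "k \<in> S"
  shows "principal_minor (\<chi> i j. A $ i $ j + (if i = k \<and> j = k then d else 0)) S
       = principal_minor A S + d * principal_minor A (S - {k})"
proof -
  have fin: "finite {p. p permutes S}"
    by (rule finite_permutations) simp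
  have prod: "(\<Prod>i\<in>S. A $ i $ p i + (if i = k \<and> p i = k then d else 0))
      = (\<Prod>i\<in>S. A $ i $ p i) + (if p k = k then d * (\<Prod>i\<in>S - {k}. A $ i $ p i) else 0)" for p
  proof -
    have "(\<Prod>i\<in>S - {k}. A $ i $ p i + (if i = k \<and> p i = k then d else 0))
        = (\<Prod>i\<in>S - {k}. A $ i $ p i)"
      by (rule prod.cong) auto
    thus ?thesis
      using assms by (simp add: prod.remove[of S k] algebra_simps)
  qed
  have fixing: "{p. p permutes S} \<inter> {p. p k = k} = {p. p permutes (S - {k})}"
  proof (intro set_eqI iffI)
    fix p assume "p \<in> {p. p permutes S} \<inter> {p. p k = k}"
    thus "p \<in> {p. p permutes (S - {k})}"
      by (auto intro: permutes_superset)
  next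
    fix p assume "p \<in> {p. p permutes (S - {k})}"
    thus "p \<in> {p. p permutes S} \<inter> {p. p k = k}"
      by (auto intro: permutes_subset simp: permutes_not_in)
  qed
  have "principal_minor (\<chi> i j. A $ i $ j + (if i = k \<and> j = k then d else 0)) S
      = principal_minor A S
        + (\<Sum>p | p permutes S. if p k = k then d * (of_int (sign p) * (\<Prod>i\<in>S - {k}. A $ i $ p i)) else 0)"
    unfolding principal_minor_def
    by (simp add: prod sum.distrib[symmetric]) (rule sum.cong, auto simp: algebra_simps)
  also have "(\<Sum>p | p permutes S. if p k = k then d * (of_int (sign p) * (\<Prod>i\<in>S - {k}. A $ i $ p i)) else 0)
      = d * principal_minor A (S - {k})"
    unfolding principal_minor_def sum_distrib_left fixing[symmetric]
    using fin by (simp add: sum.inter_restrict)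
  finally show ?thesis .
qed

lemma principal_minor_empty: "principal_minor A {} = 1"
  by (simp add: principal_minor_def)

lemma P_matrix_add_diagonal_entry:
  fixes A :: "real^'n^'n::finite"
  assumes "P_matrix A" "d \<ge> 0"
  shows "P_matrix (\<chi> i j. A $ i $ j + (if i = k \<and> j = k then d else 0))"
  unfolding P_matrix_def
proof (intro allI impI)
  fix S :: "'n set" assume S: "S \<noteq> {}"
  \<comment> \<open>The empty minor, equal to 1, is included because \<open>S - {k}\<close> may be
    empty below.\<close>
  have pos: "principal_minor A T > 0" for T
    using assms(1) by (cases "T = {}") (auto simp: P_matrix_def principal_minor_empty)
  show "principal_minor (\<chi> i j. A $ i $ j + (if i = k \<and> j = k then d else 0)) S > 0"
  proof (cases "k \<in> S")
    case True
    have "d * principal_minor A (S - {k}) \<ge> 0"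
      using pos[of "S - {k}"] assms(2) by simp
    thus ?thesis
      using principal_minor_add_diagonal_entry[OF True, of A d] pos[of S] by linarith
  next
    case False
    have "(\<Prod>i\<in>S. A $ i $ p i + (if i = k \<and> p i = k then d else 0)) = (\<Prod>i\<in>S. A $ i $ p i)" for p
      using False by (intro prod.cong) auto
    hence "principal_minor (\<chi> i j. A $ i $ j + (if i = k \<and> j = k then d else 0)) S
        = principal_minor A S"
      by (simp add: principal_minor_def)
    thus ?thesis using pos[of S] by simp
  qed
qed

lemma P_matrix_add_diagonal:
  fixes A :: "real^'n^'n::finite"
  assumes "P_matrix A" "\<And>i. d i \<ge> 0"
  shows "P_matrix (\<chi> i j. A $ i $ j + (if i = j then d i else 0))"
proof -
  \<comment> \<open>\<open>K\<close> collects the diagonal entries already increased, so they can be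
    treated one at a time.\<close>
  have "P_matrix (\<chi> i j. A $ i $ j + (if i = j \<and> i \<in> K then d i else 0))" if "finite K" for K
    using that
  proof (induction K)
    case empty
    thus ?case using assms(1) by simp
  next
    case (insert k K)
    have "(\<chi> i j. A $ i $ j + (if i = j \<and> i \<in> insert k K then d i else 0))
        = (\<chi> i j. (\<chi> i j. A $ i $ j + (if i = j \<and> i \<in> K then d i else 0)) $ i $ j
             + (if i = k \<and> j = k then d k else 0))"
      using insert.hyps by (auto simp: vec_eq_iff)
    thus ?case
      using P_matrix_add_diagonal_entry[OF insert.IH assms(2)[of k], of k] by (simp only:)
  qed
  from this[of UNIV] show ?thesis by simp
qed

section \<open>Principal submatrices\<close>

text \<open>The principal submatrix on \<open>S\<close>, padded by an identity block so that the
  index type stays \<open>'n\<close> and \<open>det\<close> applies.\<close>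

definition principal_block :: "real^'n^'n \<Rightarrow> 'n::finite set \<Rightarrow> real^'n^'n" where
  "principal_block A S =
     (\<chi> i j. if i \<in> S \<and> j \<in> S then A $ i $ j else if i = j then 1 else 0)"

text \<open>A permutation moving a point outside \<open>S\<close> meets a zero entry; every other
  one permutes \<open>T \<inter> S\<close> and picks up ones outside \<open>S\<close>.\<close>

lemma principal_minor_principal_block:
  "principal_minor (principal_block A S) T = principal_minor A (T \<inter> S)"
proof -
  let ?B = "principal_block A S"
  have fin: "finite {p. p permutes T}"
    by (rule finite_permutations) simp
  have "(\<Sum>p | p permutes T. of_int (sign p) * (\<Prod>i\<in>T. ?B $ i $ p i))
      = (\<Sum>p | p permutes (T \<inter> S). of_int (sign p) * (\<Prod>i\<in>T. ?B $ i $ p i))"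
  proof (rule sum.mono_neutral_right[OF fin])
    show "{p. p permutes (T \<inter> S)} \<subseteq> {p. p permutes T}"
      by (auto intro: permutes_subset)
    show "\<forall>p\<in>{p. p permutes T} - {p. p permutes (T \<inter> S)}.
        of_int (sign p) * (\<Prod>i\<in>T. ?B $ i $ p i) = 0"
    proof
      fix p assume p: "p \<in> {p. p permutes T} - {p. p permutes (T \<inter> S)}"
      then obtain i where "i \<in> T - T \<inter> S" "p i \<noteq> i"
        using permutes_superset[of p T "T \<inter> S"] by auto
      hence "i \<in> T" "?B $ i $ p i = 0"
        by (auto simp: principal_block_def)
      hence "(\<Prod>i\<in>T. ?B $ i $ p i) = 0"
        by (intro prod_zero) auto
      thus "of_int (sign p) * (\<Prod>i\<in>T. ?B $ i $ p i) = 0" by simp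
    qed
  qed
  also have "\<dots> = (\<Sum>p | p permutes (T \<inter> S). of_int (sign p) * (\<Prod>i\<in>T \<inter> S. A $ i $ p i))"
  proof (rule sum.cong[OF refl])
    fix p assume "p \<in> {p. p permutes (T \<inter> S)}"
    hence p: "p permutes (T \<inter> S)" by simp
    have "(\<Prod>i\<in>T. ?B $ i $ p i) = (\<Prod>i\<in>T \<inter> S. ?B $ i $ p i)"
      by (rule prod.mono_neutral_right)
        (use permutes_not_in[OF p] in \<open>auto simp: principal_block_def\<close>)
    also have "\<dots> = (\<Prod>i\<in>T \<inter> S. A $ i $ p i)"
      using permutes_in_image[OF p] by (intro prod.cong) (auto simp: principal_block_def)
    finally show "of_int (sign p) * (\<Prod>i\<in>T. ?B $ i $ p i)
        = of_int (sign p) * (\<Prod>i\<in>T \<inter> S. A $ i $ p i)" by simp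
  qed
  finally show ?thesis by (simp add: principal_minor_def)
qed

lemma P_matrix_principal_block: "P_matrix A \<Longrightarrow> P_matrix (principal_block A S)"
  unfolding P_matrix_def principal_minor_principal_block
  by (metis principal_minor_empty zero_less_one)

lemma principal_block_mult:
  fixes A :: "real^'n^'n::finite"
  assumes "i \<in> S"
  shows "(principal_block A S *v x) $ i = (A *v (\<chi> j. if j \<in> S then x $ j else 0)) $ i"
  unfolding matrix_vector_mult_def using assms
  by (auto simp: principal_block_def intro!: sum.cong)

lemma principal_block_mult_outside:
  fixes A :: "real^'n^'n::finite"
  assumes "i \<notin> S"
  shows "(principal_block A S *v x) $ i = x $ i"
proof -
  have "(principal_block A S *v x) $ i = (\<Sum>j\<in>UNIV. if i = j then x $ j else 0)"
    unfolding matrix_vector_mult_def using assms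
    by (auto simp: principal_block_def if_distrib[of "\<lambda>c. c * _"] cong: if_cong intro!: sum.cong)
  thus ?thesis by simp
qed

text \<open>Each principal minor is the determinant of a padded block, and padding commutes with
  transposition.\<close>

lemma P_matrix_transpose:
  fixes A :: "real^'n^'n::finite"
  assumes "P_matrix A"
  shows "P_matrix (transpose A)"
proof -
  have "principal_minor (transpose A) S = principal_minor A S" for S
  proof -
    have "principal_block (transpose A) S = transpose (principal_block A S)"
      by (auto simp: principal_block_def transpose_def vec_eq_iff)
    thus ?thesis
      by (metis principal_minor_principal_block principal_minor_UNIV det_transpose Int_UNIV_left)
  qed
  thus ?thesis using assms by (simp add: P_matrix_def)
qed

section \<open>Sign patterns of P-matrices\<close>

text \<open>A P-matrix reverses the sign of no nonzero vector: otherwise a nonnegative diagonal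
  matrix could be added so that \<open>x\<close>, restricted to its support, lies in the kernel of a
  P-matrix, whose determinant is positive.\<close>

lemma P_matrix_sign_reversal:
  fixes A :: "real^'n^'n::finite"
  assumes "P_matrix A" "\<And>i. x $ i * (A *v x) $ i \<le> 0"
  shows "x = 0"
proof -
  define T where "T = {i. x $ i \<noteq> 0}"
  \<comment> \<open>Chosen to cancel \<open>A *v x\<close> on the support of \<open>x\<close>; off
    the support, division by zero gives \<open>d i = 0\<close>.\<close>
  define d where "d i = - (A *v x) $ i / x $ i" for i
  have d: "d i \<ge> 0" for i
  proof -
    have "d i = - (x $ i * (A *v x) $ i) / (x $ i)\<^sup>2"
      by (simp add: d_def power2_eq_square)
    thus ?thesis using assms(2)[of i] by (simp add: divide_nonpos_nonneg)
  qed
  let ?B = "\<chi> i j. A $ i $ j + (if i = j then d i else 0)"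
  have "P_matrix (principal_block ?B T)"
    by (intro P_matrix_principal_block P_matrix_add_diagonal assms(1) d)
  hence "principal_minor (principal_block ?B T) UNIV > 0"
    unfolding P_matrix_def by blast
  hence "det (principal_block ?B T) \<noteq> 0"
    by (simp only: principal_minor_UNIV)
  \<comment> \<open>Off \<open>T\<close> the product \<open>A *v x\<close> need not vanish, so the
    rows there are replaced by identity rows.\<close>
  moreover have "principal_block ?B T *v x = 0"
  proof (subst vec_eq_iff, intro allI)
    fix i
    have x: "(\<chi> j. if j \<in> T then x $ j else 0) = x"
      by (auto simp: T_def vec_eq_iff)
    have B: "(?B *v x) $ i = (A *v x) $ i + d i * x $ i"
      by (simp add: matrix_vector_mult_def distrib_right sum.distrib if_distrib[of "\<lambda>c. c * _"]
          cong: if_cong)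
    show "(principal_block ?B T *v x) $ i = 0 $ i"
    proof (cases "i \<in> T")
      case True
      thus ?thesis
        using B by (simp only: principal_block_mult x) (simp add: T_def d_def)
    next
      case False
      thus ?thesis by (simp add: principal_block_mult_outside T_def)
    qed
  qed
  ultimately show ?thesis
    using matrix_left_invertible_ker[of "principal_block ?B T"] invertible_left_inverse
      invertible_det_nz by blast
qed

text \<open>A negative coordinate of \<open>a\<close> would let \<open>a \<bullet> p\<close> tend to
  minus infinity as that coordinate of \<open>p\<close> grows.\<close>

lemma nonneg_if_bounded_below_on_positive_vectors:
  fixes a :: "real^'n::finite"
  assumes "\<And>p. (\<And>i. p $ i > 0) \<Longrightarrow> b \<le> a \<bullet> p"
  shows "a $ i \<ge> 0"
proof (rule ccontr)
  assume "\<not> a $ i \<ge> 0"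
  hence neg: "a $ i < 0" by simp
  \<comment> \<open>Large enough that the all-ones vector with \<open>M\<close> added at
    \<open>i\<close> has inner product at most \<open>- \<bar>b\<bar> - 1\<close> with
    \<open>a\<close>.\<close>
  define M where "M = (\<bar>b\<bar> + \<bar>\<Sum>j\<in>UNIV. a $ j\<bar> + 1) / - (a $ i)"
  have M: "M \<ge> 0" "M * a $ i = - (\<bar>b\<bar> + \<bar>\<Sum>j\<in>UNIV. a $ j\<bar> + 1)"
    using neg unfolding M_def by (auto intro!: divide_nonneg_neg)
  have "b \<le> a \<bullet> (\<chi> j. 1 + (if j = i then M else 0))"
    using M by (intro assms) auto
  also have "\<dots> = (\<Sum>j\<in>UNIV. a $ j) + M * a $ i"
    by (simp add: inner_vec_def distrib_left sum.distrib if_distrib[of "\<lambda>c. _ * c"] cong: if_cong)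
  finally show False using M by linarith
qed

text \<open>Separation turns the failure of the claim into a nonzero \<open>y \<ge> 0\<close> with \<open>y v* A \<le> 0\<close>.\<close>

lemma P_matrix_positive_image:
  fixes A :: "real^'n^'n::finite"
  assumes "P_matrix A"
  obtains x where "\<And>i. x $ i > 0" "\<And>i. (A *v x) $ i > 0"
proof (rule ccontr)
  assume contra: "\<not> thesis"
  define P where "P = {p :: real^'n. \<forall>i. p $ i > 0}"
  have "(\<chi> i. 1) \<in> P" by (simp add: P_def)
  hence ne: "P \<noteq> {}" by blast
  have convP: "convex P"
  proof (rule convexI)
    fix p q :: "real^'n" and s t :: real
    assume *: "p \<in> P" "q \<in> P" "0 \<le> s" "0 \<le> t" "s + t = 1"
    have "s * p $ i + t * q $ i > 0" for i
    proof -
      have "p $ i > 0" "q $ i > 0" using * by (auto simp: P_def)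
      thus ?thesis
        using * by (cases "s = 0") (auto intro!: add_pos_nonneg mult_nonneg_nonneg)
    qed
    thus "s *\<^sub>R p + t *\<^sub>R q \<in> P" by (simp add: P_def)
  qed
  have convK: "convex ((*v) A ` P)"
    by (intro convex_linear_image convP) simp
  have "(*v) A ` P \<inter> P = {}"
    using contra that by (auto simp: P_def)
  then obtain a b where a: "a \<noteq> 0" "\<forall>x\<in>(*v) A ` P. a \<bullet> x \<le> b" "\<forall>x\<in>P. b \<le> a \<bullet> x"
    using separating_hyperplane_sets[OF convK convP] ne by auto
  have "a $ i \<ge> 0" for i
    by (rule nonneg_if_bounded_below_on_positive_vectors[of b]) (use a in \<open>auto simp: P_def\<close>)
  moreover have "(- (transpose A *v a)) $ i \<ge> 0" for i
  proof (rule nonneg_if_bounded_below_on_positive_vectors[of "- b"])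
    fix p :: "real^'n" assume "\<And>i. p $ i > 0"
    hence "a \<bullet> (A *v p) \<le> b" using a by (auto simp: P_def)
    thus "- b \<le> - (transpose A *v a) \<bullet> p"
      by (simp add: dot_lmul_matrix transpose_matrix_vector)
  qed
  \<comment> \<open>With \<open>a\<close> nonnegative and its image under the transpose nonpositive,
    the transpose would reverse the sign of \<open>a\<close>.\<close>
  ultimately have "a = 0"
    by (intro P_matrix_sign_reversal[OF P_matrix_transpose[OF assms]]) (simp add: mult_nonneg_nonpos)
  thus False using a by simp
qed

section \<open>Maps with P-matrix Jacobians\<close>

text \<open>Compactness and the absence of sign reversal bound the positive part of
  \<open>A *v y\<close> on \<open>S\<close> away from 0 over unit vectors \<open>y \<ge> 0\<close>
  supported in \<open>S\<close>. Points \<open>x\<close> arbitrarily close to \<open>a\<close> would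
  give directions where it is arbitrarily small.\<close>

lemma P_matrix_nonneg_isolated:
  fixes F :: "real^'n \<Rightarrow> real^'n::finite"
  assumes der: "(F has_derivative (\<lambda>h. A *v h)) (at a)" and P: "P_matrix A"
  obtains \<delta> where "\<delta> > 0"
    "\<And>x. \<lbrakk>a \<le> x; \<And>i. i \<notin> S \<Longrightarrow> x $ i = a $ i; \<And>i. i \<in> S \<Longrightarrow> F x $ i \<le> F a $ i;
          norm (x - a) < \<delta>\<rbrakk> \<Longrightarrow> x = a"
proof -
  define Y where "Y = {y :: real^'n. (\<forall>i. y $ i \<ge> 0) \<and> (\<forall>i. i \<notin> S \<longrightarrow> y $ i = 0) \<and> norm y = 1}"
  define \<phi> where "\<phi> y = (\<Sum>i\<in>S. max 0 ((A *v y) $ i))" for y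
  have Y: "Y = sphere 0 1 \<inter> {y. \<forall>i. 0 \<le> y $ i} \<inter> {y. \<forall>i. i \<notin> S \<longrightarrow> y $ i = 0}"
    by (auto simp: Y_def)
  have "closed {y :: real^'n. \<forall>i. 0 \<le> y $ i}"
    by (intro closed_Collect_all closed_Collect_le continuous_intros)
  moreover have "closed {y :: real^'n. \<forall>i. i \<notin> S \<longrightarrow> y $ i = 0}"
    by (intro closed_Collect_all closed_Collect_imp closed_Collect_eq continuous_intros) simp
  ultimately have compact: "compact Y"
    unfolding Y by (intro compact_Int_closed compact_sphere)
  have cont: "continuous_on Y \<phi>"
    unfolding \<phi>_def
    by (intro continuous_intros)
  have pos: "\<phi> y > 0" if "y \<in> Y" for y
  proof (rule ccontr)
    assume "\<not> \<phi> y > 0"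
    moreover have "\<phi> y \<ge> 0" by (auto simp: \<phi>_def intro: sum_nonneg)
    ultimately have "(\<Sum>i\<in>S. max 0 ((A *v y) $ i)) = 0" by (simp add: \<phi>_def)
    hence "\<forall>i\<in>S. max 0 ((A *v y) $ i) = 0"
      by (subst (asm) sum_nonneg_eq_0_iff) auto
    hence "y $ i * (A *v y) $ i \<le> 0" for i
      using that by (cases "i \<in> S") (force simp: Y_def max_def mult_nonneg_nonpos split: if_splits)+
    hence "y = 0" by (rule P_matrix_sign_reversal[OF P])
    thus False using that by (simp add: Y_def)
  qed
  \<comment> \<open>For empty \<open>Y\<close>, as when \<open>S\<close> is empty, any positive
    \<open>l\<close> serves.\<close>
  obtain l where l: "l > 0" "\<And>y. y \<in> Y \<Longrightarrow> l \<le> \<phi> y"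
  proof (cases "Y = {}")
    case False
    then obtain y0 where "y0 \<in> Y" "\<forall>y\<in>Y. \<phi> y0 \<le> \<phi> y"
      using continuous_attains_inf[OF compact _ cont] by blast
    thus ?thesis using that pos by blast
  qed (use that[of 1] in auto)
  \<comment> \<open>Makes \<open>card S\<close> errors of size \<open>e\<close> add up to less than
    \<open>l\<close>; the \<open>+ 1\<close> keeps the denominator nonzero for empty
    \<open>S\<close>.\<close>
  define e where "e = l / (2 * (real (card S) + 1))"
  have e: "e > 0" using l by (simp add: e_def)
  obtain \<delta> where \<delta>: "\<delta> > 0"
    "\<And>x. norm (x - a) < \<delta> \<Longrightarrow> norm (F x - F a - A *v (x - a)) \<le> e * norm (x - a)"
    using der e unfolding has_derivative_at_alt by blast
  show ?thesis
  proof (rule that[OF \<delta>(1)], rule ccontr)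
    fix x assume x: "a \<le> x" "\<And>i. i \<notin> S \<Longrightarrow> x $ i = a $ i"
      "\<And>i. i \<in> S \<Longrightarrow> F x $ i \<le> F a $ i" "norm (x - a) < \<delta>" "x \<noteq> a"
    define r where "r = norm (x - a)"
    have r: "r > 0" using x by (simp add: r_def)
    define y where "y = (1 / r) *\<^sub>R (x - a)"
    have "y \<in> Y"
      using x r by (auto simp: Y_def y_def r_def less_eq_vec_def)
    \<comment> \<open>Since \<open>F\<close> does not increase in coordinate \<open>i\<close>, its
      linear part is at most the approximation error.\<close>
    moreover have "(A *v y) $ i \<le> e" if "i \<in> S" for i
    proof -
      have "- (F x - F a - A *v (x - a)) $ i \<le> norm (F x - F a - A *v (x - a))"
        using component_le_norm_cart[of "F x - F a - A *v (x - a)" i] by linarith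
      also have "\<dots> \<le> e * r" using \<delta>(2)[OF x(4)] by (simp add: r_def)
      finally have "(A *v (x - a)) $ i \<le> e * r" using x(3)[OF that] by simp
      moreover have "A *v y = (1 / r) *\<^sub>R (A *v (x - a))"
        by (simp add: y_def matrix_vector_mult_scaleR)
      ultimately show ?thesis using r by (simp add: divide_le_eq)
    qed
    hence "\<phi> y \<le> (\<Sum>i\<in>S. e)"
      unfolding \<phi>_def using e by (intro sum_mono) auto
    moreover have "(\<Sum>i\<in>S. e) < l"
    proof -
      have "real (card S) * l < l * (2 * (real (card S) + 1))"
        using l(1) by (simp add: algebra_simps add_nonneg_pos)
      thus ?thesis by (simp add: e_def divide_less_eq)
    qed
    ultimately show False using l(2)[of y] by linarith
  qed
qed

text \<open>The induction on \<open>S\<close> replaces Gale and Nikaido's induction on the dimension.\<close>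

lemma P_matrix_derivative_imp_eq_on_face:
  fixes F :: "real^'n \<Rightarrow> real^'n::finite" and A :: "real^'n \<Rightarrow> real^'n^'n"
  assumes der: "\<And>x. (F has_derivative (\<lambda>h. A x *v h)) (at x)"
    and P: "\<And>x. P_matrix (A x)"
    and "a \<le> b" "\<And>i. i \<notin> S \<Longrightarrow> b $ i = a $ i" "\<And>i. i \<in> S \<Longrightarrow> F b $ i \<le> F a $ i"
  shows "b = a"
  using finite[where A = S] assms(3-)
proof (induction S arbitrary: b rule: finite_psubset_induct)
  case (psubset S)
  define D where "D = {x. a \<le> x \<and> x \<le> b \<and> (\<forall>i. i \<in> S \<longrightarrow> F x $ i \<le> F a $ i)}"
  have D_outside: "x $ i = a $ i" if "x \<in> D" "i \<notin> S" for x i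
    using that psubset.prems(2)[of i] unfolding D_def less_eq_vec_def
    by (metis (mono_tags, lifting) mem_Collect_eq order_antisym)
  obtain \<delta> where \<delta>: "\<delta> > 0" "\<And>x. x \<in> D \<Longrightarrow> norm (x - a) < \<delta> \<Longrightarrow> x = a"
  proof -
    obtain \<delta> where "\<delta> > 0"
      "\<And>x. \<lbrakk>a \<le> x; \<And>i. i \<notin> S \<Longrightarrow> x $ i = a $ i; \<And>i. i \<in> S \<Longrightarrow> F x $ i \<le> F a $ i;
          norm (x - a) < \<delta>\<rbrakk> \<Longrightarrow> x = a"
      using P_matrix_nonneg_isolated[where S = S and a = a, OF der P] by blast
    thus ?thesis
      using that[of \<delta>] D_outside unfolding D_def by blast
  qed
  have contF: "continuous_on UNIV F"
    using der by (intro has_derivative_continuous_on) (auto intro: has_derivative_at_withinI)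
  show ?case
  proof (rule ccontr)
    assume "b \<noteq> a"
    \<comment> \<open>Because \<open>a\<close> is isolated in \<open>D\<close>, this is
      \<open>D\<close> without \<open>a\<close>, and it is compact.\<close>
    define K where "K = D \<inter> {x. \<delta> \<le> norm (x - a)}"
    have bK: "b \<in> K"
      using psubset.prems \<delta>(2)[of b] \<open>b \<noteq> a\<close> by (force simp: K_def D_def)
    have "K = {a..b} \<inter> {x. \<forall>i. i \<in> S \<longrightarrow> F x $ i \<le> F a $ i} \<inter> {x. \<delta> \<le> norm (x - a)}"
      by (auto simp: K_def D_def)
    moreover have "closed {x. \<forall>i. i \<in> S \<longrightarrow> F x $ i \<le> F a $ i}"
      by (intro closed_Collect_all closed_Collect_imp closed_Collect_le continuous_intros contF) simp
    moreover have "closed {x. \<delta> \<le> norm (x - a)}"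
      by (intro closed_Collect_le continuous_intros)
    ultimately have "compact K"
      by (simp add: compact_Int_closed interval_cbox_cart)
    moreover have "continuous_on K (\<lambda>x. \<Sum>i\<in>UNIV. x $ i)"
      by (intro continuous_intros)
    \<comment> \<open>Minimising the coordinate sum yields a minimal element of \<open>K\<close> for
      the componentwise order.\<close>
    ultimately obtain c where c: "c \<in> K" "\<And>x. x \<in> K \<Longrightarrow> (\<Sum>i\<in>UNIV. c $ i) \<le> (\<Sum>i\<in>UNIV. x $ i)"
      using continuous_attains_inf[of K "\<lambda>x. \<Sum>i\<in>UNIV. x $ i"] bK by blast
    have cD: "c \<in> D" and ca: "c \<noteq> a"
      using c(1) \<delta>(1) by (auto simp: K_def)
    show False
    proof (cases "\<exists>k\<in>S. c $ k = a $ k")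
      case True
      then obtain k where k: "k \<in> S" "c $ k = a $ k" by blast
      have "c = a"
        by (rule psubset.IH[of "S - {k}"])
          (use k cD D_outside[OF cD] in \<open>auto simp: D_def\<close>)
      thus False using ca by simp
    next
      case False
      hence gt: "c $ i > a $ i" if "i \<in> S" for i
        using cD that by (force simp: D_def less_eq_vec_def order_less_le)
      obtain x where x: "\<And>i. x $ i > 0" "\<And>i. (principal_block (A c) S *v x) $ i > 0"
        using P_matrix_positive_image[OF P_matrix_principal_block[OF P]] by metis
      \<comment> \<open>Truncation to \<open>S\<close> keeps \<open>c - t *\<^sub>R h\<close> on the
        face, and on \<open>S\<close> the image \<open>A c *v h\<close> agrees with that of
        \<open>x\<close> under the block.\<close>
      define h where "h = (\<chi> j. if j \<in> S then x $ j else 0)"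
      have Ah: "(A c *v h) $ i > 0" if "i \<in> S" for i
        using x(2)[of i] principal_block_mult[OF that] by (simp add: h_def)
      have ev1: "\<forall>\<^sub>F t in at_right 0. F (c - t *\<^sub>R h) $ i < F c $ i" if "i \<in> S" for i
      proof -
        have "((\<lambda>t. F (c - t *\<^sub>R h)) has_derivative (\<lambda>t. A c *v (- (t *\<^sub>R h)))) (at 0)"
          by (rule has_derivative_compose[of "\<lambda>t. c - t *\<^sub>R h"])
            (auto intro!: derivative_eq_intros simp: der)
        hence "((\<lambda>t. F (c - t *\<^sub>R h) $ i) has_derivative (\<lambda>t. (A c *v (- (t *\<^sub>R h))) $ i)) (at 0)"
          by (rule bounded_linear.has_derivative[OF bounded_linear_vec_nth])
        moreover have "(\<lambda>t. (A c *v (- (t *\<^sub>R h))) $ i) = (*) (- (A c *v h) $ i)"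
          by (auto simp: matrix_vector_mult_scaleR simp flip: scaleR_minus_left)
        ultimately have "((\<lambda>t. F (c - t *\<^sub>R h) $ i) has_real_derivative - (A c *v h) $ i) (at 0)"
          by (simp add: has_field_derivative_def)
        from DERIV_neg_dec_right[OF this] Ah[OF that] show ?thesis
          by (auto simp: eventually_at_right_field)
      qed
      have ev2: "\<forall>\<^sub>F t in at_right 0. c $ i - t * x $ i > a $ i" if "i \<in> S" for i
      proof -
        have "((\<lambda>t. c $ i - t * x $ i) \<longlongrightarrow> c $ i - 0 * x $ i) (at_right 0)"
          by (intro tendsto_intros)
        thus ?thesis
          using gt[OF that] by (intro order_tendstoD(1)) auto
      qed
      have "\<forall>\<^sub>F t in at_right 0. t > 0 \<and>
          (\<forall>i\<in>S. F (c - t *\<^sub>R h) $ i < F c $ i \<and> c $ i - t * x $ i > a $ i)"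
        by (intro eventually_conj eventually_ball_finite ballI ev1 ev2 eventually_at_right_less) auto
      then obtain t :: real where t: "t > 0" "\<And>i. i \<in> S \<Longrightarrow> F (c - t *\<^sub>R h) $ i < F c $ i"
        "\<And>i. i \<in> S \<Longrightarrow> c $ i - t * x $ i > a $ i"
        using eventually_happens'[OF trivial_limit_at_right_real] by blast
      define c' where "c' = c - t *\<^sub>R h"
      have c'_le: "c' $ i \<le> c $ i" for i
        using t(1) x(1)[of i] by (simp add: c'_def h_def)
      obtain k where k: "k \<in> S"
        using ca D_outside[OF cD] by (force simp: vec_eq_iff)
      have "a \<le> c'"
        unfolding less_eq_vec_def
        using t(3) D_outside[OF cD] by (auto simp: c'_def h_def less_imp_le)
      moreover have "c' \<le> b"
        using c'_le cD unfolding D_def less_eq_vec_def by (blast intro: order_trans)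
      moreover have "F c' $ i \<le> F a $ i" if "i \<in> S" for i
        using t(2)[OF that] cD that by (force simp: D_def c'_def)
      ultimately have "c' \<in> D" by (simp add: D_def)
      moreover have "c' $ k > a $ k"
        using t(3)[OF k] k by (simp add: c'_def h_def)
      \<comment> \<open>The coordinate \<open>k\<close> separates \<open>c'\<close> from
        \<open>a\<close>, so isolation puts it at distance at least \<open>\<delta>\<close>.\<close>
      ultimately have "c' \<in> K"
        using \<delta>(2)[of c'] by (force simp: K_def)
      moreover have "(\<Sum>i\<in>UNIV. c' $ i) < (\<Sum>i\<in>UNIV. c $ i)"
      proof (rule sum_strict_mono_ex1)
        have "c' $ k < c $ k" using t(1) x(1)[of k] k by (simp add: c'_def h_def)
        thus "\<exists>i\<in>UNIV. c' $ i < c $ i" by blast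
      qed (use c'_le in auto)
      ultimately show False using c(2)[of c'] by simp
    qed
  qed
qed

section \<open>Application to utility functions\<close>

text \<open>The slice over \<open>y\<close> lies in \<open>X \<times> UNIV\<close> and is
  parametrised by the whole space, so the derivative within the product restricts to a full
  derivative in \<open>u\<close>.\<close>

lemma C2_on_section_differentiable:
  fixes g :: "'a::euclidean_space \<Rightarrow> real^'n::finite \<Rightarrow> real"
  assumes "C2_on (X \<times> UNIV) (\<lambda>(y, u). g y u)" "y \<in> X"
  shows "g y differentiable at u"
proof -
  obtain f' where "((\<lambda>(y, u). g y u) has_derivative blinfun_apply (f' (y, u)))
      (at (y, u) within X \<times> UNIV)"
    using assms unfolding C2_on_def by blast
  hence "((\<lambda>(y, u). g y u) has_derivative blinfun_apply (f' (y, u)))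
      (at (y, u) within range (Pair y))"
    by (rule has_derivative_subset) (use assms in auto)
  moreover have "(Pair y has_derivative (\<lambda>h. (0, h))) (at u)"
    by (intro derivative_eq_intros) auto
  ultimately have "((\<lambda>u. (\<lambda>(y, u). g y u) (y, u)) has_derivative (\<lambda>h. blinfun_apply (f' (y, u)) (0, h))) (at u)"
    by (rule has_derivative_in_compose[where f = "Pair y" and g = "\<lambda>(y, u). g y u", rotated])
  thus ?thesis by (auto simp: differentiable_def)
qed

theorem theorem1:
  fixes E X :: "'n::finite \<Rightarrow> 'a::euclidean_space set"
    and V :: "'n \<Rightarrow> 'a \<Rightarrow> real^'n \<Rightarrow> real"
    and xs :: "'n \<Rightarrow> 'a" and us :: "real^'n"
  assumes "\<And>i. subspace (E i)"
    and "\<And>i. openin (top_of_set (E i)) (X i)"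
    and "purely_affective X V"
    and "\<And>i. C2_on (X i \<times> UNIV) (\<lambda>(y, u). V i y u)"
    and "\<And>x u. x \<in> Pi UNIV X \<Longrightarrow> P_matrix (mat 1 - jacobian (utility_map V x) (at u))"
    and "parametric_equilibrium X V xs us"
  shows "pareto_optimal X V xs us"
proof -
  have False if x: "consistent X V x u'" and u': "us < u'" for x u'
  proof -
    have xX: "x \<in> Pi UNIV X" and fixed: "utility_map V x u' = u'"
      using x by (auto simp: consistent_def)
    let ?F = "\<lambda>u. u - utility_map V x u"
    let ?A = "\<lambda>u. mat 1 - jacobian (utility_map V x) (at u)"
    have "(?F has_derivative (\<lambda>h. ?A u *v h)) (at u)" for u
    proof -
      have "V i (x i) differentiable at u" for i
        using xX by (intro C2_on_section_differentiable[OF assms(4)]) auto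
      hence "utility_map V x differentiable at u"
        by (subst differentiable_componentwise_within)
          (auto simp: utility_map_def Basis_vec_def inner_axis)
      hence "(utility_map V x has_derivative (\<lambda>h. jacobian (utility_map V x) (at u) *v h)) (at u)"
        by (simp add: jacobian_works)
      from has_derivative_diff[OF has_derivative_ident this] show ?thesis
        by (simp add: matrix_vector_mult_diff_rdistrib)
    qed
    moreover have "P_matrix (?A u)" for u by (rule assms(5)[OF xX])
    moreover have "us \<le> u'" using u' by simp
    moreover have "?F u' $ i \<le> ?F us $ i" for i
    proof -
      have "utility_map V x us \<le> us"
        using assms(6) xX by (auto simp: parametric_equilibrium_def consistent_def)
      thus ?thesis using fixed by (simp add: less_eq_vec_def)
    qed
    ultimately have "u' = us"
      \<comment> \<open>With \<open>S = UNIV\<close> the face is the whole space, and the condition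
        on coordinates outside \<open>S\<close> is vacuous.\<close>
      by (intro P_matrix_derivative_imp_eq_on_face[where S = UNIV and F = ?F and A = ?A]) auto
    thus False using u' by simp
  qed
  thus ?thesis
    using assms(6) by (auto simp: pareto_optimal_def parametric_equilibrium_def)
qed

end
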